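(* Let $k\ge 1$ be an integer and $p\in[1,\infty)$. There exist constants $C>0$ and $D_0,\dots,D_{k-1}>0$, depending only on $p$ and $k$, such that the following holds. Let $A_0,\dots,A_k$ be entire functions, and consider the equation $$f^{(k)}+A_{k-1}f^{(k-1)}+\cdots+A_{1}f'+A_{0}f=A_{k}.$$ If $$C\sum_{i=0}^{k-1}D_{i}\sup_{z\in\mathbb{C}}\left\{\frac{|A_{i}(z)|}{(1+|z|)^{k-i}}\right\}<1$$ and some $k$th order primitive $\varphi_k$ of $A_k$ (i.e. $\varphi_k^{(k)}=A_k$) belongs to $F^p$, then every solution $f$ of the equation belongs to $F^p$.
   Context: $dm$ denotes Lebesgue area measure on $\mathbb{C}$. For $p\in[1,\infty)$, the Fock space $F^p$ is the space of entire functions $f$ with $\|f\|_p^p=\int_{\mathbb{C}}|f(z)e^{-\frac12|z|^2}|^p\,dm(z)<\infty$. *)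

theory Defs
  imports "HOL-Complex_Analysis.Complex_Analysis"
begin

definition fock_space :: "real \<Rightarrow> (complex \<Rightarrow> complex) set" where
  "fock_space p = {f. f holomorphic_on UNIV \<and>
     integrable lborel (\<lambda>z::complex. (norm (f z) * exp (- ((norm z) ^ 2) / 2)) powr p)}"

end

theory Submission
  imports Defs
begin

text \<open>
Moving the coefficients under the derivatives, \<open>\<Sum> A\<^sub>i f\<^bsup>(i)\<^esup> = \<Sum> (B\<^sub>i f)\<^bsup>(i)\<^esup>\<close> with \<open>B\<^sub>i\<close> as small as the
\<open>A\<^sub>i\<close> by Cauchy's estimate, turns the equation into the first-order system
\<open>x\<^sub>0 = f - \<phi>\<close>, \<open>x\<^sub>j\<^sub>+\<^sub>1 = x\<^sub>j' + B\<^sub>k\<^sub>-\<^sub>1\<^sub>-\<^sub>j f\<close>, \<open>x\<^sub>k = 0\<close>, whose forcing involves \<open>\<phi>\<close> but none of its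
derivatives. Let \<open>q = 1 + |z|\<^sup>2\<close>, \<open>V = 1 + \<Sum> L\<^bsup>2j\<^esup> |x\<^sub>j|\<^sup>2 / q\<^sup>j\<close> for a large constant \<open>L\<close>, and
\<open>G = (V\<^bsup>1/2\<^esup> e\<^bsup>-|z|^2/2\<^esup>)\<^sup>p\<close>. If the \<open>B\<^sub>i\<close> are small, the radial derivative of \<open>V\<close> is at most
\<open>q (V / 8 + V\<^bsup>1/2\<^esup> |\<phi>| / 16)\<close>, so the Gaussian dominates: with \<open>F = G / q\<close>, the divergence
\<open>2F + z \<cdot> \<nabla>F\<close> of the field \<open>F z\<close> is at most \<open>-cG\<close> plus an integrable function. Its integral over a
centred square is nonnegative, which bounds the integral of \<open>G\<close> independently of the square.
\<close>

section \<open>Integrability from a radial differential inequality\<close>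

(* For F \<ge> 0 and a centred box Q in dimension n, u^n * (integral of F(u z) over Q) equals the
   integral of F over uQ, hence is nondecreasing in u > 0; differentiate at u = 1. *)
lemma integral_radial_derivative_nonneg:
  fixes F E :: "'a::euclidean_space \<Rightarrow> real"
  assumes contF: "continuous_on UNIV F" and contE: "continuous_on UNIV E"
    and nonneg: "\<And>z. 0 \<le> F z"
    and deriv: "\<And>z. ((\<lambda>u. F (u *\<^sub>R z)) has_real_derivative E z) (at 1)"
  shows "0 \<le> integral (cbox (-a) a) (\<lambda>z. real DIM('a) * F z + E z)"
proof (rule ccontr)
  define J where "J u = u ^ DIM('a) * integral (cbox (-a) a) (\<lambda>z. F (u *\<^sub>R z))" for u :: real
  have contF': "continuous_on S F" and contE': "continuous_on S E" for S
    using contF contE continuous_on_subset by blast+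
  have intF: "(\<lambda>z. F (u *\<^sub>R z)) integrable_on cbox x y" for u x y
    by (intro integrable_continuous continuous_on_compose2[OF contF]) (auto intro!: continuous_intros)
  \<comment> \<open>Differentiability at 1 along every ray gives it at each positive v: write u z as
    (u / v)(v z) and use the hypothesis at the point v z.\<close>
  have deriv': "((\<lambda>u. F (u *\<^sub>R z)) has_real_derivative E (v *\<^sub>R z) / v) (at v within U)"
    if "v > 0" for v z U
  proof -
    have "((\<lambda>u. F (u *\<^sub>R (v *\<^sub>R z))) has_real_derivative E (v *\<^sub>R z)) (at (v / v))"
      using deriv[of "v *\<^sub>R z"] that by simp
    moreover have "((\<lambda>u. u / v) has_real_derivative 1 / v) (at v within U)"
      by (rule DERIV_cdivide) (rule DERIV_ident)
    ultimately have "((\<lambda>u. F ((u / v) *\<^sub>R (v *\<^sub>R z))) has_real_derivative E (v *\<^sub>R z) * (1 / v)) (at v within U)"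
      by (rule DERIV_chain2)
    then show ?thesis using that by simp
  qed
  \<comment> \<open>The interval stops at 1/2 to keep u away from 0, where E(u z) / u is singular. A
    left derivative at 1 suffices, since the contradiction compares \<open>J 1\<close> with earlier
    values.\<close>
  have "((\<lambda>u. integral (cbox (-a) a) (\<lambda>z. F (u *\<^sub>R z))) has_real_derivative
        integral (cbox (-a) a) (\<lambda>z. E (1 *\<^sub>R z) / 1)) (at 1 within {1/2..1})"
  proof (rule leibniz_rule_field_derivative)
    show "continuous_on ({1/2..1} \<times> cbox (-a) a) (\<lambda>(u, z). E (u *\<^sub>R z) / u)"
      unfolding split_beta
      by (intro continuous_intros continuous_on_compose2[OF contE]) auto
  qed (use deriv' intF in auto)
  then have "(J has_real_derivative
      1 ^ DIM('a) * integral (cbox (-a) a) (\<lambda>z. E z)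
      + real DIM('a) * 1 ^ (DIM('a) - 1) * integral (cbox (-a) a) (\<lambda>z. F (1 *\<^sub>R z))) (at 1 within {1/2..1})"
    unfolding J_def by (auto intro!: derivative_eq_intros)
  moreover have "integral (cbox (-a) a) (\<lambda>z. real DIM('a) * F z + E z)
      = real DIM('a) * integral (cbox (-a) a) F + integral (cbox (-a) a) E"
    using integrable_continuous[OF contF'] integrable_continuous[OF contE']
    by (subst integral_add) (auto intro: integrable_on_cmult_left)
  ultimately have J': "(J has_real_derivative
      integral (cbox (-a) a) (\<lambda>z. real DIM('a) * F z + E z)) (at 1 within {1/2..1})"
    by (simp add: algebra_simps)
  assume "\<not> ?thesis"
  then have neg: "integral (cbox (-a) a) (\<lambda>z. real DIM('a) * F z + E z) < 0" by simp
  obtain d where d: "d > 0" "\<And>h. 0 < h \<Longrightarrow> 1 - h \<in> {1/2..1} \<Longrightarrow> h < d \<Longrightarrow> J 1 < J (1 - h)"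
    using has_real_derivative_neg_dec_left[OF J' neg] by blast
  have J_eq: "J u = integral (cbox (u *\<^sub>R (-a)) (u *\<^sub>R a)) F" if "u > 0" for u
  proof -
    have "(F has_integral integral (cbox (u *\<^sub>R (-a)) (u *\<^sub>R a)) F) (cbox (u *\<^sub>R (-a)) (u *\<^sub>R a))"
      using integrable_continuous[OF contF'] by blast
    from has_integral_affinity'[OF this that, of 0] that
    show ?thesis unfolding J_def by (auto simp: integral_unique)
  qed
  have "J u \<le> J 1" if "0 < u" "u \<le> 1" for u
  proof -
    have "cbox (u *\<^sub>R (-a)) (u *\<^sub>R a) \<subseteq> cbox (-a) a"
    proof
      fix x assume x: "x \<in> cbox (u *\<^sub>R (-a)) (u *\<^sub>R a)"
      have "\<bar>x \<bullet> i\<bar> \<le> a \<bullet> i" if "i \<in> Basis" for i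
      proof -
        have *: "\<bar>x \<bullet> i\<bar> \<le> u * (a \<bullet> i)"
          using x that by (force simp: mem_box)
        \<comment> \<open>The point x makes the scaled box nonempty, which forces nonnegative
          half-widths; \<open>a\<close> itself is arbitrary.\<close>
        then have "0 \<le> a \<bullet> i" using \<open>0 < u\<close> by (smt (verit) zero_le_mult_iff)
        then have "u * (a \<bullet> i) \<le> a \<bullet> i" using \<open>u \<le> 1\<close> by (simp add: mult_left_le_one_le \<open>0 < u\<close> less_imp_le)
        with * show ?thesis by simp
      qed
      then show "x \<in> cbox (-a) a" by (force simp: mem_box)
    qed
    then have "integral (cbox (u *\<^sub>R (-a)) (u *\<^sub>R a)) F \<le> integral (cbox (-a) a) F"
      using integrable_continuous[OF contF'] nonneg by (intro integral_subset_le) auto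
    then show ?thesis using J_eq[of u] J_eq[of 1] that by simp
  qed
  moreover have "J 1 < J (1 - min (1/2) (d/2))"
    using d by (intro d(2)) (auto simp: min_def)
  ultimately show False
    using d(1) by (smt (verit) min_def field_sum_of_halves)
qed

text \<open>Monotone convergence along the exhausting cubes \<open>B n\<close> gives gauge
  integrability on the whole space. Nonnegativity makes it absolute, and continuity supplies the
  Borel measurability for passing from \<open>lebesgue\<close> to \<open>lborel\<close>.\<close>

lemma integrable_lborel_if_cbox_integrals_bounded:
  fixes G :: "'a::euclidean_space \<Rightarrow> real"
  assumes cont: "continuous_on UNIV G" and nonneg: "\<And>z. 0 \<le> G z"
    and bound: "\<And>a. integral (cbox (-a) a) G \<le> M"
  shows "integrable lborel G"
proof -
  define B where "B n = cbox (- (real n *\<^sub>R One)) (real n *\<^sub>R One :: 'a)" for n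
  have int: "G integrable_on B n" for n
    unfolding B_def using cont continuous_on_subset by (blast intro: integrable_continuous)
  have UN: "\<exists>n0. \<forall>n\<ge>n0. x \<in> B n" for x
  proof -
    obtain n0 :: nat where n0: "norm x \<le> real n0" using real_arch_simple by blast
    have "x \<in> B n" if "n \<ge> n0" for n
      unfolding B_def mem_box
    proof clarsimp
      fix i :: 'a assume "i \<in> Basis"
      then show "- real n \<le> x \<bullet> i \<and> x \<bullet> i \<le> real n"
        using Basis_le_norm[of i x] n0 that by auto
    qed
    then show ?thesis by blast
  qed
  have "G integrable_on UNIV \<and> (\<lambda>n. integral UNIV (\<lambda>x. if x \<in> B n then G x else 0)) \<longlonglongrightarrow> integral UNIV G"
  proof (rule monotone_convergence_increasing)
    show "(\<lambda>x. if x \<in> B n then G x else 0) integrable_on UNIV" for n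
      using int by (simp add: integrable_restrict_UNIV)
    have "B n \<subseteq> B (Suc n)" for n
      unfolding B_def by (intro subset_box_imp) auto
    then show "(if x \<in> B n then G x else 0) \<le> (if x \<in> B (Suc n) then G x else 0)" for n x
      using nonneg by auto
    show "(\<lambda>n. if x \<in> B n then G x else 0) \<longlonglongrightarrow> G x" for x
      using UN[of x] by (intro tendsto_eventually) (auto simp: eventually_sequentially)
    have "integral UNIV (\<lambda>x. if x \<in> B n then G x else 0) = integral (B n) G" for n
      by (simp add: integral_restrict_UNIV)
    moreover have "0 \<le> integral (B n) G" for n
      using int nonneg by (simp add: integral_nonneg)
    moreover have "integral (B n) G \<le> M" for n
      unfolding B_def by (rule bound)
    ultimately show "bounded (range (\<lambda>n. integral UNIV (\<lambda>x. if x \<in> B n then G x else 0)))"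
      by (auto simp: bounded_iff intro!: exI[of _ M])
  qed
  then have "G absolutely_integrable_on UNIV"
    using nonneg by (simp add: nonnegative_absolutely_integrable_1)
  then have "integrable lebesgue G" by (simp add: set_integrable_def)
  then show ?thesis
    using borel_measurable_continuous_onI[OF cont] by (subst (asm) integrable_completion) auto
qed

text \<open>The bracket in the last hypothesis stands for the divergence of the vector field F(z) z.
  Its integral over a centred box is nonnegative, so adding it to the integral of \<open>G\<close>
  can only increase it, and \<open>h\<close> then bounds the result.\<close>

lemma integrable_by_radial_derivative:
  fixes F E G h :: "'a::euclidean_space \<Rightarrow> real"
  assumes contF: "continuous_on UNIV F" and contE: "continuous_on UNIV E" and contG: "continuous_on UNIV G"
    and "\<And>z. 0 \<le> F z" and "\<And>z. 0 \<le> G z"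
    and deriv: "\<And>z. ((\<lambda>u. F (u *\<^sub>R z)) has_real_derivative E z) (at 1)"
    and h: "integrable lborel h"
    and le: "\<And>z. G z + (real DIM('a) * F z + E z) \<le> h z"
  shows "integrable lborel G"
proof (rule integrable_lborel_if_cbox_integrals_bounded)
  \<comment> \<open>\<open>h\<close> may change sign; for its absolute value, the integral over a
    box is at most the one over the whole space, which is the uniform bound.\<close>
  have absh: "(\<lambda>z. \<bar>h z\<bar>) integrable_on UNIV" "(\<lambda>z. \<bar>h z\<bar>) integrable_on cbox x y" for x y
    using integrable_on_lborel[OF integrable_abs[OF h]] integrable_on_subcbox by blast+
  fix a :: 'a
  let ?B = "cbox (-a) a"
  have FE: "(\<lambda>z. real DIM('a) * F z + E z) integrable_on ?B"
    by (intro integrable_continuous continuous_intros) (use contF contE continuous_on_subset in blast)+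
  have G: "G integrable_on ?B"
    by (intro integrable_continuous) (use contG continuous_on_subset in blast)
  have "integral ?B G \<le> integral ?B G + integral ?B (\<lambda>z. real DIM('a) * F z + E z)"
    using integral_radial_derivative_nonneg[OF contF contE assms(4) deriv] by simp
  also have "\<dots> = integral ?B (\<lambda>z. G z + (real DIM('a) * F z + E z))"
    using integral_add[OF G FE] by simp
  also have "\<dots> \<le> integral ?B (\<lambda>z. \<bar>h z\<bar>)"
    using le by (intro integral_le integrable_add G FE absh) (auto intro: order_trans[OF _ abs_ge_self])
  also have "\<dots> \<le> integral UNIV (\<lambda>z. \<bar>h z\<bar>)"
    by (intro integral_subset_le absh) auto
  finally show "integral ?B G \<le> integral UNIV (\<lambda>z. \<bar>h z\<bar>)" .
qed (use assms in auto)

section \<open>Pointwise inequalities for the Gaussian-weighted energy\<close>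

text \<open>A substitute for Young's inequality: the first summand dominates when b \<le> a, the
  second otherwise. It turns a term linear in \<phi> into a p-th power.\<close>

lemma powr_mult_quotient_le:
  fixes a b p :: real
  assumes "a > 0" "b \<ge> 0" "p \<ge> 1"
  shows "a powr p * (b / a) \<le> a powr p + b powr p"
proof (cases "b \<le> a")
  case True
  then have "a powr p * (b / a) \<le> a powr p" using assms by (intro mult_left_le) auto
  then show ?thesis by (smt (verit) powr_ge_zero)
next
  case False
  have "a powr p = a powr (p - 1) * a" using assms by (simp add: powr_mult_base powr_diff)
  then have "a powr p * (b / a) = a powr (p - 1) * b" using assms by simp
  also have "\<dots> \<le> b powr (p - 1) * b"
    using False assms by (intro mult_right_mono powr_mono2) auto
  also have "\<dots> = b powr p" using False assms by (simp add: powr_diff)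
  finally show ?thesis by (smt (verit) powr_ge_zero)
qed

lemma powr_add_le:
  fixes a b p :: real
  assumes "a \<ge> 0" "b \<ge> 0" "p \<ge> 0"
  shows "(a + b) powr p \<le> 2 powr p * (a powr p + b powr p)"
proof -
  have "(a + b) powr p \<le> (2 * max a b) powr p"
    using assms by (intro powr_mono2) auto
  also have "\<dots> = 2 powr p * max a b powr p" using assms by (simp add: powr_mult)
  also have "\<dots> \<le> 2 powr p * (a powr p + b powr p)"
    by (intro mult_left_mono) (auto simp: max_def)
  finally show ?thesis .
qed

text \<open>Here t is |z|^2 and d the radial derivative of V. With F = G / (1 + t), the Gaussian
  contributes -p t F = -p G + p F. Against -p G stand p/16 and p/32 of G from the bound on d, and
  p/2 of G absorbing (2 + p) F for large t; what remains of the coefficient of p G is 1 - 1/16 -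
  1/32 - 1/2 = 13/32.\<close>

lemma weighted_radial_bound:
  fixes V d t \<Phi> p :: real
  assumes V: "V \<ge> 1" and t: "t \<ge> 0" and \<Phi>: "\<Phi> \<ge> 0" and p: "p \<ge> 1"
    and d: "d \<le> (1 + t) * (V / 8 + sqrt V * \<Phi> / 16)"
  defines "G \<equiv> (sqrt V * exp (- t / 2)) powr p"
  shows "13 / 32 * p * G + (2 * (G / (1 + t)) + G / (1 + t) * (p / 2 * (d / V) - p * t - 2 * t / (1 + t)))
    \<le> (2 + p) * (if t < 9 then G else 0) + p / 32 * (\<Phi> * exp (- t / 2)) powr p"
proof -
  define F where "F = G / (1 + t)"
  have sV: "sqrt V \<ge> 1" using V by simp
  have G: "G > 0" unfolding G_def using V by simp
  have F: "F > 0" "G = F * (1 + t)" using G t by (auto simp: F_def)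
  have "d / V \<le> (1 + t) * (1 / 8 + \<Phi> / sqrt V / 16)"
  proof -
    have "(1 + t) * (V / 8 + sqrt V * \<Phi> / 16) = (1 + t) * (1 / 8 + \<Phi> / sqrt V / 16) * V"
    proof -
      have "V = sqrt V * sqrt V" "sqrt V \<noteq> 0" using V by simp_all
      moreover have "(1 + t) * (N * N / 8 + N * \<Phi> / 16) = (1 + t) * (1 / 8 + \<Phi> / N / 16) * (N * N)"
        if "N \<noteq> 0" for N :: real
        using that by (simp add: field_simps)
      ultimately show ?thesis by metis
    qed
    with d have "d \<le> (1 + t) * (1 / 8 + \<Phi> / sqrt V / 16) * V" by (rule ord_le_eq_trans)
    then show ?thesis using V by (simp only: pos_divide_le_eq)
  qed
  then have "F * (p / 2 * (d / V)) \<le> F * (p / 2 * ((1 + t) * (1 / 8 + \<Phi> / sqrt V / 16)))"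
    using F p by (intro mult_left_mono) auto
  also have "\<dots> = p / 16 * G + p / 32 * (G * (\<Phi> / sqrt V))"
  proof -
    have "F * (p / 2 * ((1 + t) * (1 / 8 + r / 16))) = p / 16 * (F * (1 + t)) + p / 32 * (F * (1 + t) * r)" for r
      by (simp add: algebra_simps)
    then show ?thesis unfolding F(2) .
  qed
  finally have 1: "F * (p / 2 * (d / V)) \<le> p / 16 * G + p / 32 * (G * (\<Phi> / sqrt V))" .
  \<comment> \<open>Inserting the Gaussian above and below makes the denominator the number whose
    p-th power is \<open>G\<close>.\<close>
  have "G * (\<Phi> / sqrt V) = G * ((\<Phi> * exp (- t / 2)) / (sqrt V * exp (- t / 2)))"
    by simp
  also have "\<dots> \<le> G + (\<Phi> * exp (- t / 2)) powr p"
    unfolding G_def using V \<Phi> p by (intro powr_mult_quotient_le) auto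
  finally have "p / 32 * (G * (\<Phi> / sqrt V)) \<le> p / 32 * (G + (\<Phi> * exp (- t / 2)) powr p)"
    using p by (intro mult_left_mono) auto
  \<comment> \<open>For t \<ge> 9, p/2 * (1 + t) \<ge> 5 p \<ge> 2 + p because p \<ge> 1; for
    smaller t the term is kept, on a bounded region.\<close>
  moreover have "(2 + p) * F \<le> p / 2 * G + (2 + p) * (if t < 9 then G else 0)"
  proof (cases "t < 9")
    case True
    have "F * 1 \<le> F * (1 + t)" using F t by (intro mult_left_mono) auto
    then have "(2 + p) * F \<le> (2 + p) * G" using p F(2) by (intro mult_left_mono) auto
    moreover have "0 \<le> p / 2 * G" using p G by simp
    ultimately show ?thesis using True by simp
  next
    case False
    have "(2 + p) * F \<le> (p / 2 * (1 + t)) * F"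
    proof (rule mult_right_mono)
      have "p / 2 * 10 \<le> p / 2 * (1 + t)" using False p by (intro mult_left_mono) auto
      then show "2 + p \<le> p / 2 * (1 + t)" using p by linarith
    qed (use F in simp)
    then show ?thesis using False F(2) by (simp add: mult_ac)
  qed
  moreover have "F * (p * t) = p * G - p * F" using F(2) by (simp add: algebra_simps)
  moreover have "0 \<le> F * (2 * t / (1 + t))" using F t by simp
  moreover have "F * (p / 2 * (d / V) - p * t - 2 * t / (1 + t))
      = F * (p / 2 * (d / V)) - F * (p * t) - F * (2 * t / (1 + t))"
    by (simp only: right_diff_distrib)
  ultimately show ?thesis using 1 unfolding F_def[symmetric] by (simp add: algebra_simps)
qed

lemma norm_squared_radial_derivative:
  fixes x :: "complex \<Rightarrow> complex"
  assumes "x holomorphic_on UNIV"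
  shows "((\<lambda>u. (norm (x (u *\<^sub>R z)))\<^sup>2) has_real_derivative 2 * (x z \<bullet> (z * deriv x z))) (at 1)"
proof -
  have "(x has_field_derivative deriv x (1 *\<^sub>R z)) (at (1 *\<^sub>R z))"
    using assms holomorphic_derivI by blast
  moreover have "((\<lambda>u. u *\<^sub>R z) has_vector_derivative z) (at 1)"
    by (auto intro!: derivative_eq_intros)
  ultimately have "((x \<circ> (\<lambda>u. u *\<^sub>R z)) has_vector_derivative (z * deriv x (1 *\<^sub>R z))) (at 1)"
    using field_vector_diff_chain_at by blast
  then have "((\<lambda>u. x (u *\<^sub>R z)) has_derivative (\<lambda>h. h *\<^sub>R (z * deriv x z))) (at 1)"
    by (simp add: has_vector_derivative_def o_def)
  from has_derivative_inner[OF this this] show ?thesis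
    unfolding has_field_derivative_def power2_norm_eq_inner
    by (rule has_derivative_eq_rhs) (auto simp: inner_commute)
qed

section \<open>Moving coefficients under the derivatives\<close>

text \<open>Cauchy's estimate on the unit circle about z: there 1 + |w| \<le> 2 (1 + |z|), whence
  the factor 2^n.\<close>

lemma norm_deriv_le_growth:
  assumes A: "A holomorphic_on UNIV" and bound: "\<And>z. norm (A z) \<le> a * (1 + norm z) ^ n"
  shows "norm (deriv A z) \<le> (2 ^ n * a) * (1 + norm z) ^ n"
proof -
  have a: "0 \<le> a" using bound[of 0] norm_ge_zero[of "A 0"] by (simp del: norm_ge_zero)
  have "norm ((deriv ^^ 1) A z) \<le> fact 1 * (a * (2 * (1 + norm z)) ^ n) / 1 ^ 1"
  proof (rule Cauchy_inequality)
    show "A holomorphic_on ball z 1" "continuous_on (cball z 1) A"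
      using A holomorphic_on_subset holomorphic_on_imp_continuous_on by blast+
    fix w assume "norm (z - w) = 1"
    then have "norm w \<le> norm z + 1"
      by (metis add.commute norm_minus_commute norm_triangle_sub)
    then have "1 + norm w \<le> 2 * (1 + norm z)"
      using norm_ge_zero[of z] by argo
    then have "(1 + norm w) ^ n \<le> (2 * (1 + norm z)) ^ n"
      by (rule power_mono) simp
    then have "a * (1 + norm w) ^ n \<le> a * (2 * (1 + norm z)) ^ n"
      using a by (rule mult_left_mono)
    then show "norm (A w) \<le> a * (2 * (1 + norm z)) ^ n" using bound[of w] by simp
  qed simp
  then show ?thesis unfolding power_mult_distrib by (simp add: mult_ac)
qed

lemma higher_deriv_sum:
  assumes "\<And>i. i \<in> I \<Longrightarrow> g i holomorphic_on UNIV"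
  shows "(deriv ^^ n) (\<lambda>w. \<Sum>i\<in>I. g i w) z = (\<Sum>i\<in>I. (deriv ^^ n) (g i) z)"
  using assms
proof (induction I rule: infinite_finite_induct)
  case (insert x F)
  then show ?case
    by (simp add: higher_deriv_add[of _ UNIV] holomorphic_on_sum)
qed (simp_all add: higher_deriv_const)

text \<open>Induction on j through A f^(j+1) = (A f^(j))' - A' f^(j): the hypothesis applies to A
  and to A', which has the same growth order. \<open>K\<close> is quantified before \<open>A\<close>
  and \<open>a\<close>, so it depends only on n and j.\<close>

lemma mult_higher_deriv_as_sum:
  "\<exists>K\<ge>0. \<forall>A a. A holomorphic_on UNIV \<longrightarrow> (\<forall>z. norm (A z) \<le> a * (1 + norm z) ^ n) \<longrightarrow>
     (\<exists>c::nat \<Rightarrow> complex \<Rightarrow> complex. (\<forall>i. c i holomorphic_on UNIV) \<and>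
       (\<forall>i z. norm (c i z) \<le> K * a * (1 + norm z) ^ n) \<and> 
       (\<forall>f z. f holomorphic_on UNIV \<longrightarrow>
         A z * (deriv ^^ j) f z = (\<Sum>i\<le>j. (deriv ^^ i) (\<lambda>w. c i w * f w) z)))"
proof (induction j)
  case 0
  show ?case
    by (intro exI[of _ 1]) (auto intro!: exI[of _ "\<lambda>_. _"])
next
  case (Suc j)
  then obtain K where K: "K \<ge> 0" and IH: "\<And>A a. A holomorphic_on UNIV \<Longrightarrow> (\<And>z. norm (A z) \<le> a * (1 + norm z) ^ n) \<Longrightarrow>
     \<exists>c::nat \<Rightarrow> complex \<Rightarrow> complex. (\<forall>i. c i holomorphic_on UNIV) \<and>
       (\<forall>i z. norm (c i z) \<le> K * a * (1 + norm z) ^ n) \<and> 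
       (\<forall>f z. f holomorphic_on UNIV \<longrightarrow>
         A z * (deriv ^^ j) f z = (\<Sum>i\<le>j. (deriv ^^ i) (\<lambda>w. c i w * f w) z))"
    by blast
  show ?case
  proof (intro exI[of _ "K + K * 2 ^ n"] conjI allI impI)
    show "0 \<le> K + K * 2 ^ n" using K by simp
    fix A and a assume A: "A holomorphic_on UNIV" and bound: "\<forall>z. norm (A z) \<le> a * (1 + norm z) ^ n"
    have a: "0 \<le> a" using bound[rule_format, of 0] norm_ge_zero[of "A 0"] by (simp del: norm_ge_zero)
    obtain c where c: "\<And>i. c i holomorphic_on UNIV"
      "\<And>i z. norm (c i z) \<le> K * a * (1 + norm z) ^ n"
      "\<And>f z. f holomorphic_on UNIV \<Longrightarrow>
         A z * (deriv ^^ j) f z = (\<Sum>i\<le>j. (deriv ^^ i) (\<lambda>w. c i w * f w) z)"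
      using IH[OF A] bound by blast
    have "\<exists>d::nat \<Rightarrow> complex \<Rightarrow> complex. (\<forall>i. d i holomorphic_on UNIV) \<and>
       (\<forall>i z. norm (d i z) \<le> K * (2 ^ n * a) * (1 + norm z) ^ n) \<and> 
       (\<forall>f z. f holomorphic_on UNIV \<longrightarrow>
         deriv A z * (deriv ^^ j) f z = (\<Sum>i\<le>j. (deriv ^^ i) (\<lambda>w. d i w * f w) z))"
      using A bound by (intro IH norm_deriv_le_growth) (auto intro: holomorphic_deriv)
    then obtain d where d: "\<And>i. d i holomorphic_on UNIV"
      "\<And>i z. norm (d i z) \<le> K * (2 ^ n * a) * (1 + norm z) ^ n"
      "\<And>f z. f holomorphic_on UNIV \<Longrightarrow>
         deriv A z * (deriv ^^ j) f z = (\<Sum>i\<le>j. (deriv ^^ i) (\<lambda>w. d i w * f w) z)"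
      by blast
    \<comment> \<open>Differentiating the expansion for A shifts its indices up by one, leaving
      coefficient 0 at index 0. The expansion for A' is padded by zero at index j + 1, so that both
      sums run over the same range.\<close>
    define c' where "c' i z = (if i = 0 then 0 else c (i - 1) z)" for i z
    define d' where "d' i z = (if i \<le> j then d i z else 0)" for i z
    define e where "e i z = c' i z - d' i z" for i z
    have c': "c' i holomorphic_on UNIV" for i
      using c(1)[of "i - 1"] by (cases "i = 0") (simp_all add: c'_def[abs_def])
    have d': "d' i holomorphic_on UNIV" for i
      using d(1)[of i] by (cases "i \<le> j") (simp_all add: d'_def[abs_def])
    show "\<exists>e::nat \<Rightarrow> complex \<Rightarrow> complex. (\<forall>i. e i holomorphic_on UNIV) \<and>
       (\<forall>i z. norm (e i z) \<le> (K + K * 2 ^ n) * a * (1 + norm z) ^ n) \<and> 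
       (\<forall>f z. f holomorphic_on UNIV \<longrightarrow>
         A z * (deriv ^^ Suc j) f z = (\<Sum>i\<le>Suc j. (deriv ^^ i) (\<lambda>w. e i w * f w) z))"
    proof (intro exI[of _ e] conjI allI impI)
      show "e i holomorphic_on UNIV" for i
        using c'[of i] d'[of i] unfolding e_def[abs_def] by (intro holomorphic_intros)
      have "norm (c' i z) \<le> K * a * (1 + norm z) ^ n" "norm (d' i z) \<le> K * (2 ^ n * a) * (1 + norm z) ^ n" for i z
        using c(2)[of "i - 1" z] d(2)[of i z] K a by (auto simp: c'_def d'_def)
      then show "norm (e i z) \<le> (K + K * 2 ^ n) * a * (1 + norm z) ^ n" for i z
        unfolding e_def using norm_triangle_ineq4[of "c' i z" "d' i z"]
        by (smt (verit) distrib_right mult.assoc)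
      fix f :: "complex \<Rightarrow> complex" and z assume f: "f holomorphic_on UNIV"
      have hol_cf: "(\<lambda>w. c i w * f w) holomorphic_on UNIV" for i
        using c(1)[of i] f by (intro holomorphic_intros)
      \<comment> \<open>Both sides of the expansion for A are differentiated and compared by
        uniqueness of the derivative.\<close>
      have "((\<lambda>w. A w * (deriv ^^ j) f w) has_field_derivative
              A z * (deriv ^^ Suc j) f z + deriv A z * (deriv ^^ j) f z) (at z)"
        using DERIV_mult[OF holomorphic_derivI[OF A open_UNIV UNIV_I, of z]
            has_field_derivative_higher_deriv[OF f open_UNIV UNIV_I, where x = z and n = j]]
        by (simp add: algebra_simps)
      moreover have "((\<lambda>w. \<Sum>i\<le>j. (deriv ^^ i) (\<lambda>w. c i w * f w) w) has_field_derivative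
              (\<Sum>i\<le>j. (deriv ^^ Suc i) (\<lambda>w. c i w * f w) z)) (at z)"
        by (intro DERIV_sum has_field_derivative_higher_deriv[OF hol_cf]) auto
      ultimately have "A z * (deriv ^^ Suc j) f z + deriv A z * (deriv ^^ j) f z
          = (\<Sum>i\<le>j. (deriv ^^ Suc i) (\<lambda>w. c i w * f w) z)"
        unfolding c(3)[OF f] by (rule DERIV_unique)
      then have "A z * (deriv ^^ Suc j) f z
          = (\<Sum>i\<le>j. (deriv ^^ Suc i) (\<lambda>w. c i w * f w) z) - deriv A z * (deriv ^^ j) f z"
        by (simp only: eq_diff_eq)
      also have "(\<Sum>i\<le>j. (deriv ^^ Suc i) (\<lambda>w. c i w * f w) z)
          = (\<Sum>i\<le>Suc j. (deriv ^^ i) (\<lambda>w. c' i w * f w) z)"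
        by (subst sum.atMost_Suc_shift) (simp add: c'_def)
      also have "deriv A z * (deriv ^^ j) f z = (\<Sum>i\<le>Suc j. (deriv ^^ i) (\<lambda>w. d' i w * f w) z)"
        unfolding d(3)[OF f] by (simp add: d'_def higher_deriv_const del: funpow.simps)
      also have "(\<Sum>i\<le>Suc j. (deriv ^^ i) (\<lambda>w. c' i w * f w) z) - (\<Sum>i\<le>Suc j. (deriv ^^ i) (\<lambda>w. d' i w * f w) z)
          = (\<Sum>i\<le>Suc j. (deriv ^^ i) (\<lambda>w. e i w * f w) z)"
        unfolding sum_subtractf[symmetric] e_def left_diff_distrib
        using c' d' f
        by (intro sum.cong refl higher_deriv_diff[of _ UNIV, symmetric]) (auto intro!: holomorphic_intros)
      finally show "A z * (deriv ^^ Suc j) f z = (\<Sum>i\<le>Suc j. (deriv ^^ i) (\<lambda>w. e i w * f w) z)" .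
    qed
  qed
qed

section \<open>Energy estimate for the first-order system\<close>

lemma inner_mult_complex_le: "x \<bullet> (z * y) \<le> norm x * (norm z * norm y)" for x y z :: complex
  using norm_cauchy_schwarz[of x "z * y"] by (simp add: norm_mult)

text \<open>Dividing |x_j|^2 by q^j charges one factor sqrt q per derivative, matching the growth of
  \<open>b j\<close>. The powers of \<open>L\<close> make both couplings small: x_(j+1) enters the
  rescaled equation with factor 1 / L, and x_0 + \<phi> with factor L^j \<beta>.\<close>

lemma radial_system_integrable:
  fixes x b :: "nat \<Rightarrow> complex \<Rightarrow> complex" and \<phi> :: "complex \<Rightarrow> complex" and \<beta> L p :: real
  assumes k: "k \<ge> 1" and p: "p \<ge> 1"
    and x: "\<And>j. x j holomorphic_on UNIV"
    and ode: "\<And>j z. j < k \<Longrightarrow> deriv (x j) z = x (Suc j) z - b j z * (x 0 z + \<phi> z)"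
    and last: "\<And>z. x k z = 0"
    and b: "\<And>j z. j < k \<Longrightarrow> norm (b j z) \<le> \<beta> * sqrt (1 + (norm z)\<^sup>2) ^ Suc j"
    and L: "L \<ge> 32 * real k" and \<beta>: "\<And>j. j < k \<Longrightarrow> L ^ j * \<beta> \<le> 1 / (32 * real k)"
    and \<phi>: "integrable lborel (\<lambda>z. (norm (\<phi> z) * exp (- ((norm z) ^ 2) / 2)) powr p)"
  shows "integrable lborel (\<lambda>z. (sqrt (1 + (norm (x 0 z))\<^sup>2) * exp (- ((norm z) ^ 2) / 2)) powr p)"
proof -
  define q where "q z = 1 + (norm z)\<^sup>2" for z :: complex
  define w where "w j z = L ^ (2 * j) / q z ^ j" for j z
  \<comment> \<open>The summand 1 keeps \<open>V\<close> positive where all x_j vanish, so its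
    logarithm and square root are differentiable.\<close>
  define V where "V z = 1 + (\<Sum>j<k. w j z * (norm (x j z))\<^sup>2)" for z
  (* d and E are the radial derivatives of V and G / q. Dividing by q absorbs the factor q in the
     bound for d, which would otherwise put an unbounded weight on \<phi>. *)
  define d where "d z = (\<Sum>j<k. w j z * (2 * (x j z \<bullet> (z * deriv (x j) z)))
      - real j * (2 * (norm z)\<^sup>2 / q z) * w j z * (norm (x j z))\<^sup>2)" for z
  define G where "G z = (sqrt (V z) * exp (- ((norm z) ^ 2) / 2)) powr p" for z
  define E where "E z = G z / q z * (p / 2 * (d z / V z) - p * (norm z)\<^sup>2 - 2 * (norm z)\<^sup>2 / q z)" for z
  have L0: "L > 0" using L k by linarith
  have q: "q z \<ge> 1" "q z > 0" "q z \<noteq> 0" for z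
  proof -
    show "q z \<ge> 1" by (simp add: q_def)
    then show "q z > 0" "q z \<noteq> 0" by linarith+
  qed
  have w: "w j z > 0" "w j z \<ge> 0" for j z
  proof -
    show "w j z > 0" using L0 q(2) by (simp add: w_def)
    then show "w j z \<ge> 0" by linarith
  qed
  have V1: "V z \<ge> 1" for z
    using w by (simp add: V_def sum_nonneg less_imp_le)
  have wx: "(\<Sum>j<k. w j z * (norm (x j z))\<^sup>2) \<le> V z" for z by (simp add: V_def)
  have d_le: "d z \<le> q z * (V z / 8 + sqrt (V z) * norm (\<phi> z) / 16)" for z
  proof -
    define s where "s = sqrt (q z)"
    define N where "N = sqrt (V z)"
    \<comment> \<open>The rescaled unknowns: y_j^2 is the j-th summand of V, so y_j \<le> N. The
      bound is also required at j = k, where x_k = 0, because the equation for x_(k-1) involves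
      x_k.\<close>
    define y where "y j = L ^ j * norm (x j z) / s ^ j" for j
    have s: "s \<ge> 1" "s * s = q z" using q[of z] by (auto simp: s_def)
    have N: "N \<ge> 1" "N * N = V z" using V1[of z] by (auto simp: N_def)
    have w_eq: "w j z = (L ^ j / s ^ j) * (L ^ j / s ^ j)" for j
      by (simp add: w_def s(2)[symmetric] power_mult_distrib power_mult power2_eq_square)
    have y_le: "y j \<le> N" if "j \<le> k" for j
    proof (cases "j = k")
      case True
      then show ?thesis using last N by (simp add: y_def)
    next
      case False
      have "(y j)\<^sup>2 = w j z * (norm (x j z))\<^sup>2" by (simp add: w_eq y_def power2_eq_square)
      also have "\<dots> \<le> (\<Sum>j<k. w j z * (norm (x j z))\<^sup>2)"
        using False that w by (intro member_le_sum) auto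
      also have "\<dots> \<le> N\<^sup>2" using wx N by (simp add: power2_eq_square)
      finally show ?thesis by (rule power2_le_imp_le) (use N in simp)
    qed
    have y0: "y j \<ge> 0" for j using s L0 by (simp add: y_def)
    have term_le: "w j z * (2 * (x j z \<bullet> (z * deriv (x j) z)))
      - real j * (2 * (norm z)\<^sup>2 / q z) * w j z * (norm (x j z))\<^sup>2
      \<le> q z * (N * N + N * norm (\<phi> z) / 2) / (8 * real k)" if j: "j < k" for j
    proof -
      have "norm (deriv (x j) z) \<le> norm (x (Suc j) z) + norm (b j z) * norm (x 0 z + \<phi> z)"
        unfolding ode[OF j] norm_mult[symmetric] by (rule norm_triangle_ineq4)
      also have "\<dots> \<le> norm (x (Suc j) z) + (\<beta> * s ^ Suc j) * (norm (x 0 z) + norm (\<phi> z))"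
        using b[OF j, of z] by (intro add_left_mono mult_mono norm_triangle_ineq)
          (use order_trans[OF norm_ge_zero b[OF j, of z]] in \<open>simp_all add: s_def q_def\<close>)
      finally have der: "norm (deriv (x j) z) \<le> \<dots>" .
      have zs: "norm z \<le> s" by (simp add: s_def q_def real_le_rsqrt)
      have "L ^ j / s ^ j * s * norm (deriv (x j) z)
          \<le> L ^ j / s ^ j * s * (norm (x (Suc j) z) + (\<beta> * s ^ Suc j) * (norm (x 0 z) + norm (\<phi> z)))"
        using s L0 by (intro mult_left_mono der) auto
      \<comment> \<open>After rescaling, the same factor s * s = q comes out for every j, and both
        couplings have coefficients at most 1 / (32 k).\<close>
      also have "\<dots> = s * s * (y (Suc j) / L + L ^ j * \<beta> * (y 0 + norm (\<phi> z)))"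
        using s(1) L0 by (simp add: y_def field_simps)
      also have "\<dots> \<le> s * s * (N / (32 * real k) + 1 / (32 * real k) * (N + norm (\<phi> z)))"
        using L L0 k j y_le[of "Suc j"] y_le[of 0] y0 \<beta>[OF j] N
        by (intro mult_left_mono add_mono mult_mono frac_le) auto
      finally have *: "L ^ j / s ^ j * s * norm (deriv (x j) z) \<le> \<dots>" .
      have "w j z * (2 * (x j z \<bullet> (z * deriv (x j) z))) \<le> w j z * (2 * (norm (x j z) * (s * norm (deriv (x j) z))))"
        using zs w(2) 
        by (intro mult_left_mono order_trans[OF inner_mult_complex_le] mult_right_mono) auto
      also have "\<dots> = 2 * y j * (L ^ j / s ^ j * s * norm (deriv (x j) z))"
        by (simp add: w_eq y_def)
      also have "\<dots> \<le> 2 * N * (s * s * (N / (32 * real k) + 1 / (32 * real k) * (N + norm (\<phi> z))))"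
        using N y_le[of j] j s L0 y0[of j] by (intro mult_mono * ) auto
      also have "\<dots> = q z * (N * N + N * norm (\<phi> z) / 2) / (8 * real k)"
        unfolding s(2) using k by (simp add: field_simps)
      finally have "w j z * (2 * (x j z \<bullet> (z * deriv (x j) z))) \<le> \<dots>" .
      \<comment> \<open>The weights decrease radially, so their contribution to the derivative is
        nonpositive and is dropped.\<close>
      moreover have "0 \<le> real j * (2 * (norm z)\<^sup>2 / q z) * w j z * (norm (x j z))\<^sup>2"
        using w(2)[of j z] q(2)[of z] by (intro mult_nonneg_nonneg divide_nonneg_pos) auto
      ultimately show ?thesis by linarith
    qed
    have "d z \<le> (\<Sum>j<k. q z * (N * N + N * norm (\<phi> z) / 2) / (8 * real k))"
      unfolding d_def by (intro sum_mono term_le) auto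
    also have "\<dots> = q z * (V z / 8 + N * norm (\<phi> z) / 16)"
      using k N by (simp add: field_simps)
    finally show ?thesis by (simp add: N_def)
  qed
  have contx: "continuous_on UNIV (x j)" "continuous_on UNIV (deriv (x j))" for j
    using x holomorphic_on_imp_continuous_on holomorphic_deriv open_UNIV by blast+
  have contq: "continuous_on UNIV q" unfolding q_def[abs_def] by (intro continuous_intros)
  have contw: "continuous_on UNIV (w j)" for j
    unfolding w_def[abs_def] using q(3) by (intro continuous_intros contq) auto
  have contV: "continuous_on UNIV V"
    unfolding V_def[abs_def] by (intro continuous_intros contw contx)
  have contd: "continuous_on UNIV d"
    unfolding d_def[abs_def] using q(3) by (intro continuous_intros contw contx contq) auto
  have G_pos: "0 < G z" for z
    using V1[of z] by (simp add: G_def)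
  have contG: "continuous_on UNIV G"
    unfolding G_def[abs_def]
  proof (intro continuous_intros contV ballI)
    show "sqrt (V z) * exp (- ((norm z) ^ 2) / 2) \<noteq> 0" for z using V1[of z] by auto
  qed auto
  have contE: "continuous_on UNIV E"
    unfolding E_def[abs_def] using q(3) V1
    by (intro continuous_intros contG contd contV contq) (auto, smt (verit))
  have derivq: "((\<lambda>u. q (u *\<^sub>R z)) has_real_derivative 2 * (norm z)\<^sup>2) (at 1)" for z
    unfolding q_def by (auto intro!: derivative_eq_intros simp: power_mult_distrib)
  have derivw: "((\<lambda>u. w j (u *\<^sub>R z)) has_real_derivative - real j * (2 * (norm z)\<^sup>2 / q z) * w j z) (at 1)" for j z
  proof -
    have "((\<lambda>u. L ^ (2 * j) / q (u *\<^sub>R z) ^ j) has_real_derivative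
        - (L ^ (2 * j) * (real j * (2 * (norm z)\<^sup>2 * q z ^ (j - 1)))) / (q z ^ j * q z ^ j)) (at 1)"
      using q(3)[of z] by (auto intro!: derivative_eq_intros derivq)
    also have "- (L ^ (2 * j) * (real j * (2 * (norm z)\<^sup>2 * q z ^ (j - 1)))) / (q z ^ j * q z ^ j)
        = - real j * (2 * (norm z)\<^sup>2 / q z) * w j z"
      using q(3)[of z] by (cases j) (auto simp: w_def field_simps)
    finally show ?thesis unfolding w_def .
  qed
  have derivV: "((\<lambda>u. V (u *\<^sub>R z)) has_real_derivative d z) (at 1)" for z
    unfolding V_def d_def
    by (rule derivative_eq_intros norm_squared_radial_derivative[OF x] derivw refl)+
       (auto simp: algebra_simps sum.distrib sum_subtractf)
  \<comment> \<open>In logarithmic form the radial derivative of G / q becomes that of a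
    sum.\<close>
  have G_exp: "G z / q z = exp (p / 2 * ln (V z) - p / 2 * (norm z)\<^sup>2 - ln (q z))" for z
  proof -
    have "G z = exp (p * (ln (V z) / 2 - (norm z)\<^sup>2 / 2))"
      using V1[of z] by (simp add: G_def powr_def ln_mult ln_sqrt)
    then show ?thesis using q(2)[of z] by (simp add: exp_diff exp_add algebra_simps)
  qed
  have derivF: "((\<lambda>u. G (u *\<^sub>R z) / q (u *\<^sub>R z)) has_real_derivative E z) (at 1)" for z
  proof -
    have "((\<lambda>u. (norm (u *\<^sub>R z))\<^sup>2) has_real_derivative 2 * (norm z)\<^sup>2) (at 1)"
      using DERIV_diff[OF derivq[of z] DERIV_const[of 1]] by (simp add: q_def)
    moreover have "((\<lambda>u. ln (V (u *\<^sub>R z))) has_real_derivative 1 / V z * d z) (at 1)"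
      using less_le_trans[OF zero_less_one V1[of z]]
      by (intro DERIV_chain2[OF _ derivV]) (auto intro: DERIV_ln_divide)
    moreover have "((\<lambda>u. ln (q (u *\<^sub>R z))) has_real_derivative 1 / q z * (2 * (norm z)\<^sup>2)) (at 1)"
      using q(2)[of z] by (intro DERIV_chain2[OF _ derivq]) (auto intro: DERIV_ln_divide)
    ultimately have "((\<lambda>u. p / 2 * ln (V (u *\<^sub>R z)) - p / 2 * (norm (u *\<^sub>R z))\<^sup>2 - ln (q (u *\<^sub>R z)))
        has_real_derivative p / 2 * (1 / V z * d z) - p / 2 * (2 * (norm z)\<^sup>2) - 1 / q z * (2 * (norm z)\<^sup>2)) (at 1)"
      by (intro DERIV_diff DERIV_cmult)
    from DERIV_fun_exp[OF this] show ?thesis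
      unfolding E_def G_exp by simp
  qed
  \<comment> \<open>The ball of radius 3 covers the region |z|^2 < 9 left over in the pointwise
    bound; a continuous function on it is integrable by compactness.\<close>
  define h where "h z = (2 + p) * (indicator (cball 0 3) z *\<^sub>R G z)
      + p / 32 * (norm (\<phi> z) * exp (- ((norm z) ^ 2) / 2)) powr p" for z
  have int_h: "integrable lborel h"
    unfolding h_def[abs_def]
    by (intro Bochner_Integration.integrable_add integrable_mult_right \<phi>
        borel_integrable_compact compact_cball continuous_on_subset[OF contG subset_UNIV])
  have le_h: "13 / 32 * p * G z + (real DIM(complex) * (G z / q z) + E z) \<le> h z" for z
  proof -
    have "13 / 32 * p * G z + (2 * (G z / q z) + E z)
      \<le> (2 + p) * (if (norm z)\<^sup>2 < 9 then G z else 0) + p / 32 * (norm (\<phi> z) * exp (- ((norm z)\<^sup>2) / 2)) powr p"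
      unfolding E_def G_def q_def
      using d_le[of z] V1[of z] p by (intro weighted_radial_bound) (auto simp: q_def)
    also have "(if (norm z)\<^sup>2 < 9 then G z else 0) \<le> indicator (cball 0 3) z *\<^sub>R G z"
    proof (cases "(norm z)\<^sup>2 < 9")
      case True
      then have "norm z < 3" using power2_less_imp_less[of "norm z" 3] by simp
      then show ?thesis using G_pos[of z] by simp
    next
      case False
      then show ?thesis using less_imp_le[OF G_pos[of z]] by (simp add: indicator_def)
    qed
    finally show ?thesis using p by (simp add: h_def mult_left_mono)
  qed
  have "integrable lborel (\<lambda>z. 13 / 32 * p * G z)"
  proof (rule integrable_by_radial_derivative[OF _ contE _ _ _ derivF int_h le_h])
    show "continuous_on UNIV (\<lambda>z. G z / q z)"
      using q(3) by (intro continuous_intros contG contq) auto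
    show "continuous_on UNIV (\<lambda>z. 13 / 32 * p * G z)"
      by (intro continuous_intros contG)
    show "0 \<le> G z / q z" "0 \<le> 13 / 32 * p * G z" for z
      using q(2)[of z] G_pos[of z] p by simp_all
  qed
  then have "integrable lborel (\<lambda>z. 32 / 13 / p * (13 / 32 * p * G z))"
    by (rule integrable_mult_right)
  then have "integrable lborel G" using p by simp
  then show ?thesis
  proof (rule Bochner_Integration.integrable_bound)
    have "continuous_on UNIV (\<lambda>z. (sqrt (1 + (norm (x 0 z))\<^sup>2) * exp (- ((norm z) ^ 2) / 2)) powr p)"
      by (intro continuous_intros contx ballI) (auto simp: add_nonneg_eq_0_iff)
    then show "(\<lambda>z. (sqrt (1 + (norm (x 0 z))\<^sup>2) * exp (- ((norm z) ^ 2) / 2)) powr p) \<in> borel_measurable lborel"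
      by (simp add: borel_measurable_continuous_onI)
    have "1 + (norm (x 0 z))\<^sup>2 \<le> V z" for z
    proof -
      have "w 0 z * (norm (x 0 z))\<^sup>2 \<le> (\<Sum>j<k. w j z * (norm (x j z))\<^sup>2)"
        using k w by (intro member_le_sum) auto
      then show ?thesis by (simp add: V_def w_def)
    qed
    then show "AE z in lborel. norm ((sqrt (1 + (norm (x 0 z))\<^sup>2) * exp (- ((norm z) ^ 2) / 2)) powr p) \<le> norm (G z)"
      using p by (auto simp: G_def intro!: AE_I2 powr_mono2 mult_right_mono)
  qed
qed

section \<open>From the equation to the system\<close>

text \<open>The recursion is unrolled so that its k-th term can be compared with the differential
  equation; g_i is differentiated once at each step after it enters.\<close>

lemma companion_chain_closed_form:
  fixes x g :: "nat \<Rightarrow> complex \<Rightarrow> complex"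
  assumes "x 0 holomorphic_on UNIV" and g: "\<And>j. g j holomorphic_on UNIV"
    and step: "\<And>j z. x (Suc j) z = deriv (x j) z + g j z"
  shows "x j holomorphic_on UNIV \<and> x j = (\<lambda>z. (deriv ^^ j) (x 0) z + (\<Sum>i<j. (deriv ^^ (j - Suc i)) (g i) z))"
proof (induction j)
  case 0
  then show ?case using assms(1) by simp
next
  case (Suc j)
  then have hol: "x j holomorphic_on UNIV"
    and eq: "x j = (\<lambda>z. (deriv ^^ j) (x 0) z + (\<Sum>i<j. (deriv ^^ (j - Suc i)) (g i) z))"
    by blast+
  have "x (Suc j) holomorphic_on UNIV"
    using holomorphic_on_add[OF holomorphic_deriv[OF hol open_UNIV] g[of j]]
    by (simp add: step[abs_def])
  moreover have "x (Suc j) z = (deriv ^^ Suc j) (x 0) z + (\<Sum>i<Suc j. (deriv ^^ (Suc j - Suc i)) (g i) z)" for z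
  proof -
    have "((\<lambda>z. (deriv ^^ j) (x 0) z + (\<Sum>i<j. (deriv ^^ (j - Suc i)) (g i) z)) has_field_derivative
        (deriv ^^ Suc j) (x 0) z + (\<Sum>i<j. (deriv ^^ Suc (j - Suc i)) (g i) z)) (at z)"
      by (intro DERIV_add DERIV_sum has_field_derivative_higher_deriv[of _ UNIV] assms(1) g) auto
    then have "deriv (x j) z = (deriv ^^ Suc j) (x 0) z + (\<Sum>i<j. (deriv ^^ Suc (j - Suc i)) (g i) z)"
      unfolding eq[symmetric] by (rule DERIV_imp_deriv)
    also have "(\<Sum>i<j. (deriv ^^ Suc (j - Suc i)) (g i) z) = (\<Sum>i<j. (deriv ^^ (Suc j - Suc i)) (g i) z)"
      by (intro sum.cong) (auto simp: Suc_diff_Suc simp del: funpow.simps)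
    finally show ?thesis by (simp add: step del: funpow.simps)
  qed
  ultimately show ?case by blast
qed

text \<open>Exchanges the weight 1 + |z| for the smooth weight sqrt q; the factor 2^k serves all
  exponents up to k.\<close>

lemma one_plus_power_le_sqrt:
  fixes r :: real
  assumes "r \<ge> 0" and "n \<le> k"
  shows "(1 + r) ^ n \<le> 2 ^ k * sqrt (1 + r\<^sup>2) ^ n"
proof -
  have "r \<le> sqrt (1 + r\<^sup>2)" "1 \<le> sqrt (1 + r\<^sup>2)" by (simp_all add: real_le_rsqrt)
  then have "1 + r \<le> 2 * sqrt (1 + r\<^sup>2)" by linarith
  then have "(1 + r) ^ n \<le> (2 * sqrt (1 + r\<^sup>2)) ^ n" using assms by (intro power_mono) auto
  also have "\<dots> = 2 ^ n * sqrt (1 + r\<^sup>2) ^ n" by (simp add: power_mult_distrib)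
  also have "\<dots> \<le> 2 ^ k * sqrt (1 + r\<^sup>2) ^ n"
    using assms by (intro mult_right_mono power_increasing) auto
  finally show ?thesis .
qed

section \<open>Choice of constants and conclusion\<close>

theorem theorem1p1:
  fixes k :: nat and p :: real
  assumes "k \<ge> 1" and "1 \<le> p"
  shows "\<exists>C::real. C > 0 \<and> (\<exists>D::nat \<Rightarrow> real. (\<forall>i<k. D i > 0) \<and>
    (\<forall>A::nat \<Rightarrow> complex \<Rightarrow> complex.
      (\<forall>i\<le>k. A i holomorphic_on UNIV) \<longrightarrow>
      (\<forall>i<k. bdd_above (range (\<lambda>z. norm (A i z) / (1 + norm z) ^ (k - i)))) \<longrightarrow>
      C * (\<Sum>i<k. D i * (SUP z. norm (A i z) / (1 + norm z) ^ (k - i))) < 1 \<longrightarrow>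
      (\<exists>\<phi>. \<phi> holomorphic_on UNIV \<and> (\<forall>z. (deriv ^^ k) \<phi> z = A k z) \<and> \<phi> \<in> fock_space p) \<longrightarrow>
      (\<forall>f. f holomorphic_on UNIV \<longrightarrow>
         (\<forall>z. (deriv ^^ k) f z + (\<Sum>i<k. A i z * (deriv ^^ i) f z) = A k z) \<longrightarrow>
         f \<in> fock_space p)))"
proof -
  \<comment> \<open>The expansion constants are chosen before any coefficients are given, so they
    depend only on k.\<close>
  have "\<exists>K. \<forall>j. K j \<ge> 0 \<and> (\<forall>A a. A holomorphic_on UNIV \<longrightarrow> (\<forall>z. norm (A z) \<le> a * (1 + norm z) ^ (k - j)) \<longrightarrow>
     (\<exists>c::nat \<Rightarrow> complex \<Rightarrow> complex. (\<forall>i. c i holomorphic_on UNIV) \<and>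
       (\<forall>i z. norm (c i z) \<le> K j * a * (1 + norm z) ^ (k - j)) \<and>
       (\<forall>f z. f holomorphic_on UNIV \<longrightarrow>
         A z * (deriv ^^ j) f z = (\<Sum>i\<le>j. (deriv ^^ i) (\<lambda>w. c i w * f w) z))))"
    by (rule choice) (intro allI mult_higher_deriv_as_sum)
  then obtain K :: "nat \<Rightarrow> real" where K0: "\<And>j. K j \<ge> 0"
    and K: "\<And>j. (\<forall>A a. A holomorphic_on UNIV \<longrightarrow> (\<forall>z. norm (A z) \<le> a * (1 + norm z) ^ (k - j)) \<longrightarrow>
     (\<exists>c::nat \<Rightarrow> complex \<Rightarrow> complex. (\<forall>i. c i holomorphic_on UNIV) \<and>
       (\<forall>i z. norm (c i z) \<le> K j * a * (1 + norm z) ^ (k - j)) \<and>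
       (\<forall>f z. f holomorphic_on UNIV \<longrightarrow>
         A z * (deriv ^^ j) f z = (\<Sum>i\<le>j. (deriv ^^ i) (\<lambda>w. c i w * f w) z))))"
    by blast
  define S where "S = (\<Sum>j<k. K j)"
  define L where "L = 32 * real k"
  \<comment> \<open>Chosen so that L^j 2^k S / M \<le> 1 / (32 k) for j < k. The factor 2^k pays for
    the change of weight, and S + 1 keeps \<open>M\<close> positive even if S = 0.\<close>
  define M where "M = 32 * real k * L ^ k * 2 ^ k * (S + 1)"
  have S: "S \<ge> 0" unfolding S_def using K0 by (simp add: sum_nonneg)
  have L: "L \<ge> 1" using assms(1) by (simp add: L_def)
  have M: "M > 0" unfolding M_def using assms(1) L S by simp
  have "f \<in> fock_space p"
    if A: "\<And>i. i \<le> k \<Longrightarrow> A i holomorphic_on UNIV"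
      and bdd: "\<And>i. i < k \<Longrightarrow> bdd_above (range (\<lambda>z. norm (A i z) / (1 + norm z) ^ (k - i)))"
      and small: "(\<Sum>i<k. M * (SUP z. norm (A i z) / (1 + norm z) ^ (k - i))) < 1"
      and \<phi>: "\<phi> holomorphic_on UNIV" "\<And>z. (deriv ^^ k) \<phi> z = A k z" "\<phi> \<in> fock_space p"
      and f: "f holomorphic_on UNIV"
      and eq: "\<And>z. (deriv ^^ k) f z + (\<Sum>i<k. A i z * (deriv ^^ i) f z) = A k z"
    for A :: "nat \<Rightarrow> complex \<Rightarrow> complex" and \<phi> f
  proof -
    define s where "s i = (SUP z. norm (A i z) / (1 + norm z) ^ (k - i))" for i
    \<comment> \<open>\<open>SUP\<close> of an unbounded set of reals carries no information;
      \<open>bdd\<close> makes \<open>s i\<close> a genuine upper bound.\<close>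
    have quot_le: "norm (A i z) / (1 + norm z) ^ (k - i) \<le> s i" if "i < k" for i z
      unfolding s_def by (rule cSUP_upper[OF UNIV_I bdd[OF that]])
    have s0: "s i \<ge> 0" if "i < k" for i
      using order_trans[OF _ quot_le[OF that, of 0]] by simp
    have s_le: "s i \<le> 1 / M" if "i < k" for i
    proof -
      have "M * s i \<le> (\<Sum>i<k. M * s i)"
        using that M s0 by (intro member_le_sum) auto
      then have "M * s i \<le> 1" using small by (simp add: s_def)
      then show ?thesis using M by (simp add: field_simps)
    qed
    have A_le: "norm (A i z) \<le> (1 / M) * (1 + norm z) ^ (k - i)" if "i < k" for i z
    proof -
      have pos: "0 < (1 + norm z) ^ (k - i)" by (intro zero_less_power) (simp add: add_pos_nonneg)
      then have "norm (A i z) \<le> s i * (1 + norm z) ^ (k - i)"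
        using quot_le[OF that, of z] by (simp add: pos_divide_le_eq)
      also have "\<dots> \<le> (1 / M) * (1 + norm z) ^ (k - i)"
        using s_le[OF that] pos by (intro mult_right_mono) auto
      finally show ?thesis .
    qed
    have "\<exists>c::nat \<Rightarrow> complex \<Rightarrow> complex. j < k \<longrightarrow> (\<forall>i. c i holomorphic_on UNIV) \<and>
       (\<forall>i z. norm (c i z) \<le> K j * (1 / M) * (1 + norm z) ^ (k - j)) \<and>
       (\<forall>f z. f holomorphic_on UNIV \<longrightarrow>
         A j z * (deriv ^^ j) f z = (\<Sum>i\<le>j. (deriv ^^ i) (\<lambda>w. c i w * f w) z))" for j
    proof (cases "j < k")
      case True
      then show ?thesis using K[rule_format, OF A[of j] A_le[OF True]] by simp
    qed simp
    then have "\<exists>c. \<forall>j. j < k \<longrightarrow> (\<forall>i. c j i holomorphic_on UNIV) \<and>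
       (\<forall>i z. norm (c j i z) \<le> K j * (1 / M) * (1 + norm z) ^ (k - j)) \<and>
       (\<forall>f z. f holomorphic_on UNIV \<longrightarrow>
         A j z * (deriv ^^ j) f z = (\<Sum>i\<le>j. (deriv ^^ i) (\<lambda>w. c j i w * f w) z))"
      by (intro choice allI)
    then obtain c where c: "\<And>i j. j < k \<Longrightarrow> c j i holomorphic_on UNIV"
       "\<And>i j z. j < k \<Longrightarrow> norm (c j i z) \<le> K j * (1 / M) * (1 + norm z) ^ (k - j)"
       "\<And>j z. j < k \<Longrightarrow> A j z * (deriv ^^ j) f z = (\<Sum>i\<le>j. (deriv ^^ i) (\<lambda>w. c j i w * f w) z)"
      using f by blast
    \<comment> \<open>Zero beyond i = j turns the triangular double sum into a square one, whose
      order can be swapped. For i \<le> j the exponent k - j may be raised to k - i, so the bound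
      depends on the order i of the outer derivative.\<close>
    define c' where "c' j i z = (if i \<le> j then c j i z else 0)" for j i z
    have c': "c' j i holomorphic_on UNIV" if "j < k" for i j
      using c(1)[OF that, of i] by (cases "i \<le> j") (simp_all add: c'_def[abs_def])
    have c'_le: "norm (c' j i z) \<le> K j * ((1 / M) * (1 + norm z) ^ (k - i))" if "j < k" for i j z
    proof (cases "i \<le> j")
      case True
      have "norm (c' j i z) \<le> K j * (1 / M) * (1 + norm z) ^ (k - j)"
        using c(2)[OF that] True by (simp add: c'_def)
      also have "\<dots> \<le> K j * (1 / M) * (1 + norm z) ^ (k - i)"
        using True K0 M by (intro mult_left_mono power_increasing) auto
      finally show ?thesis by (simp only: mult.assoc)
    qed (use K0 M in \<open>simp add: c'_def\<close>)
    define B where "B i z = (\<Sum>j<k. c' j i z)" for i z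
    have B: "B i holomorphic_on UNIV" for i
      unfolding B_def[abs_def] by (intro holomorphic_on_sum c') auto
    have B_le: "norm (B i z) \<le> S * ((1 / M) * (1 + norm z) ^ (k - i))" for i z
      unfolding B_def S_def sum_distrib_right by (intro sum_norm_le c'_le) auto
    have reorder: "(\<Sum>j<k. A j z * (deriv ^^ j) f z) = (\<Sum>i<k. (deriv ^^ i) (\<lambda>w. B i w * f w) z)" for z
    proof -
      have "(\<Sum>j<k. A j z * (deriv ^^ j) f z) = (\<Sum>j<k. \<Sum>i<k. (deriv ^^ i) (\<lambda>w. c' j i w * f w) z)"
      proof (intro sum.cong refl)
        fix j assume j: "j \<in> {..<k}"
        have "A j z * (deriv ^^ j) f z = (\<Sum>i\<le>j. (deriv ^^ i) (\<lambda>w. c' j i w * f w) z)"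
          using c(3)[of j z] j by (simp add: c'_def)
        also have "\<dots> = (\<Sum>i<k. (deriv ^^ i) (\<lambda>w. c' j i w * f w) z)"
          using j by (intro sum.mono_neutral_left) (auto simp: c'_def higher_deriv_const)
        finally show "A j z * (deriv ^^ j) f z = \<dots>" .
      qed
      also have "\<dots> = (\<Sum>i<k. \<Sum>j<k. (deriv ^^ i) (\<lambda>w. c' j i w * f w) z)"
        by (rule sum.swap)
      also have "\<dots> = (\<Sum>i<k. (deriv ^^ i) (\<lambda>w. B i w * f w) z)"
        unfolding B_def sum_distrib_right
        by (intro sum.cong refl higher_deriv_sum[symmetric] holomorphic_on_mult c' f) auto
      finally show ?thesis .
    qed
    \<comment> \<open>A Horner scheme: B_(k-1) f enters first and B_0 f last, so B_i f is
      differentiated exactly i times by stage k. Starting from f - \<phi> removes A_k, the k-th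
      derivative of \<phi>, and the equation then says that x_k = 0.\<close>
    define x where "x j = rec_nat (\<lambda>z. f z - \<phi> z) (\<lambda>j g z. deriv g z + B (k - Suc j) z * f z) j" for j
    have x0: "x 0 = (\<lambda>z. f z - \<phi> z)" and x_Suc: "x (Suc j) z = deriv (x j) z + B (k - Suc j) z * f z" for j z
      by (simp_all add: x_def)
    have x_form: "x j holomorphic_on UNIV \<and> x j = (\<lambda>z. (deriv ^^ j) (x 0) z
        + (\<Sum>i<j. (deriv ^^ (j - Suc i)) (\<lambda>w. B (k - Suc i) w * f w) z))" for j
    proof (rule companion_chain_closed_form)
      show "x 0 holomorphic_on UNIV" unfolding x0 by (intro holomorphic_intros f \<phi>)
      show "(\<lambda>w. B (k - Suc j) w * f w) holomorphic_on UNIV" for j by (intro holomorphic_intros B f)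
    qed (rule x_Suc)
    have x_hol: "x j holomorphic_on UNIV" for j using x_form by blast
    have x_last: "x k z = 0" for z
    proof -
      have "x k z = (deriv ^^ k) (x 0) z + (\<Sum>i<k. (deriv ^^ (k - Suc i)) (\<lambda>w. B (k - Suc i) w * f w) z)"
        using x_form[of k] by metis
      also have "(\<Sum>i<k. (deriv ^^ (k - Suc i)) (\<lambda>w. B (k - Suc i) w * f w) z) = (\<Sum>i<k. (deriv ^^ i) (\<lambda>w. B i w * f w) z)"
        by (rule sum.nat_diff_reindex)
      also have "(deriv ^^ k) (x 0) z = (deriv ^^ k) f z - (deriv ^^ k) \<phi> z"
        unfolding x0 by (intro higher_deriv_diff[of _ UNIV] f \<phi>) auto
      finally show ?thesis unfolding \<phi>(2) eq[of z, symmetric] reorder by simp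
    qed
    have S_M: "L ^ j * (2 ^ k * (S / M)) \<le> 1 / (32 * real k)" if "j < k" for j
    proof -
      have "L ^ j * (2 ^ k * S) \<le> L ^ k * (2 ^ k * (S + 1))"
        using L S that by (intro mult_mono power_increasing) auto
      then have "L ^ j * (2 ^ k * S) / M \<le> L ^ k * (2 ^ k * (S + 1)) / M"
        using M by (intro divide_right_mono) auto
      also have "\<dots> = 1 / (32 * real k)"
      proof -
        have "L ^ k * (2 ^ k * (S + 1)) \<noteq> 0" using L S by simp
        moreover have "M = 32 * real k * (L ^ k * (2 ^ k * (S + 1)))"
          by (simp only: M_def mult.assoc)
        ultimately show ?thesis by simp
      qed
      finally show ?thesis by simp
    qed
    have \<phi>_int: "integrable lborel (\<lambda>z. (norm (\<phi> z) * exp (- ((norm z) ^ 2) / 2)) powr p)"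
      using \<phi>(3) by (simp add: fock_space_def)
    have x_int: "integrable lborel (\<lambda>z. (sqrt (1 + (norm (x 0 z))\<^sup>2) * exp (- ((norm z) ^ 2) / 2)) powr p)"
    \<comment> \<open>Index k - Suc j gives growth exponent Suc j, as the system requires. Since f =
      x_0 + \<phi>, the forcing contains \<phi> undifferentiated.\<close>
    proof (rule radial_system_integrable[where \<beta> = "2 ^ k * (S / M)" and L = L and b = "\<lambda>j. B (k - Suc j)" and \<phi> = \<phi>])
      show "deriv (x j) z = x (Suc j) z - B (k - Suc j) z * (x 0 z + \<phi> z)" for j z
        by (simp add: x_Suc x0)
      show "norm (B (k - Suc j) z) \<le> 2 ^ k * (S / M) * sqrt (1 + (norm z)\<^sup>2) ^ Suc j" if "j < k" for j z
      proof -
        have "norm (B (k - Suc j) z) \<le> (S / M) * (1 + norm z) ^ Suc j"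
          using B_le[of "k - Suc j" z] that by (simp add: Suc_diff_Suc)
        also have "\<dots> \<le> (S / M) * (2 ^ k * sqrt (1 + (norm z)\<^sup>2) ^ Suc j)"
          using that S M by (intro mult_left_mono one_plus_power_le_sqrt) auto
        finally show ?thesis by (simp only: mult_ac)
      qed
      show "32 * real k \<le> L" by (simp add: L_def)
    qed (rule assms x_hol x_last S_M \<phi>_int; assumption)+
    have "integrable lborel (\<lambda>z. (norm (f z) * exp (- ((norm z) ^ 2) / 2)) powr p)"
    proof (rule Bochner_Integration.integrable_bound)
      show "integrable lborel (\<lambda>z. 2 powr p * ((sqrt (1 + (norm (x 0 z))\<^sup>2) * exp (- ((norm z) ^ 2) / 2)) powr p
          + (norm (\<phi> z) * exp (- ((norm z) ^ 2) / 2)) powr p))"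
        by (intro integrable_mult_right Bochner_Integration.integrable_add x_int \<phi>_int)
      have "f \<in> borel_measurable borel"
        using f holomorphic_on_imp_continuous_on borel_measurable_continuous_onI by blast
      then show "(\<lambda>z. (norm (f z) * exp (- ((norm z) ^ 2) / 2)) powr p) \<in> borel_measurable lborel"
        by simp
      have "(norm (f z) * exp (- ((norm z) ^ 2) / 2)) powr p
        \<le> 2 powr p * ((sqrt (1 + (norm (x 0 z))\<^sup>2) * exp (- ((norm z) ^ 2) / 2)) powr p
          + (norm (\<phi> z) * exp (- ((norm z) ^ 2) / 2)) powr p)" for z
      proof -
        have "norm (x 0 z) \<le> sqrt (1 + (norm (x 0 z))\<^sup>2)" by (simp add: real_le_rsqrt)
        then have "norm (f z) \<le> sqrt (1 + (norm (x 0 z))\<^sup>2) + norm (\<phi> z)"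
          using norm_triangle_ineq[of "x 0 z" "\<phi> z"] by (simp add: x0)
        then have "norm (f z) * exp (- ((norm z) ^ 2) / 2)
          \<le> sqrt (1 + (norm (x 0 z))\<^sup>2) * exp (- ((norm z) ^ 2) / 2) + norm (\<phi> z) * exp (- ((norm z) ^ 2) / 2)"
          unfolding distrib_right[symmetric] by (intro mult_right_mono) auto
        then have "(norm (f z) * exp (- ((norm z) ^ 2) / 2)) powr p
          \<le> (sqrt (1 + (norm (x 0 z))\<^sup>2) * exp (- ((norm z) ^ 2) / 2) + norm (\<phi> z) * exp (- ((norm z) ^ 2) / 2)) powr p"
          using assms(2) by (intro powr_mono2) auto
        also note powr_add_le
        finally show ?thesis using assms(2) by simp
      qed
      then show "AE z in lborel. norm ((norm (f z) * exp (- ((norm z) ^ 2) / 2)) powr p)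
        \<le> norm (2 powr p * ((sqrt (1 + (norm (x 0 z))\<^sup>2) * exp (- ((norm z) ^ 2) / 2)) powr p
          + (norm (\<phi> z) * exp (- ((norm z) ^ 2) / 2)) powr p))"
        by (intro AE_I2) (auto intro: order_trans[OF _ abs_ge_self])
    qed
    then show ?thesis using f by (simp add: fock_space_def)
  qed
  \<comment> \<open>\<open>C\<close> is 1: the whole smallness requirement sits in \<open>D\<close>,
    constant and equal to \<open>M\<close>.\<close>
  then show ?thesis
    using M by (intro exI[of _ "1::real"] conjI exI[of _ "\<lambda>_. M"] allI impI) auto
qed

end
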